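(* Let $\mathbf{p}_1,\ldots,\mathbf{p}_d\in\Pi^n_o$, $P=(\mathbf{p}_1,\ldots,\mathbf{p}_d)$, and let $\mathcal{C}\in\otimes^d\mathbb{R}^n$ be given. Denote by $\tau(\mathcal{C},P)=\min\{\langle\mathcal{C},\mathcal{U}\rangle:\mathcal{U}\in\mathrm{U}(P)\}$ the value of the tensor optimal transport problem. Let $\lambda>0$ and $\mathcal{A}=\exp(-\lambda\mathcal{C})=[e^{-\lambda c_{i_1,\ldots,i_d}}]$. Fix $\varepsilon\in(0,1/2)$, run the Sinkhorn algorithm (described in the context) with $\mathcal{A}_0=\frac1{\|\mathcal{A}\|_1}\mathcal{A}$, and let $k^{stop}\ge 0$ be the first $k\ge0$ for which $$\max\Big\{\Big\|\mathbf{s}_j(\mathcal{A}_{k})-\frac{\langle\mathbf{s}_j(\mathcal{A}_{k}),\mathbf{p}_j\rangle}{\|\mathbf{p}_j\|^2}\mathbf{p}_j\Big\|_1:\ j\in[d]\Big\}<\varepsilon .$$ Let $\mathcal{B}\in\mathrm{U}(P)$ be obtained from $\mathcal{A}_{k^{stop}}$ using the Replacement Algorithm (described in the context). Then $$\langle\mathcal{C},\mathcal{B}\rangle<\tau(\mathcal{C},P)+\frac{d\log n}{\lambda}+8d\,\|\mathcal{C}\|_\infty\,\varepsilon .$$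
   Context: $[n]=\{1,\ldots,n\}$, $d\ge2$. $\otimes^d\mathbb{R}^n$ is the space of real tensors $\mathcal{U}=[u_{i_1,\ldots,i_d}]$, $i_1,\ldots,i_d\in[n]$; $\otimes^d\mathbb{R}^n_+$ those with nonnegative entries; $\langle\mathcal{C},\mathcal{U}\rangle=\sum c_{i_1,\ldots,i_d}u_{i_1,\ldots,i_d}$; $\|\mathcal{C}\|_\infty=\max|c_{i_1,\ldots,i_d}|$; $\|\mathcal{A}\|_1$ is the sum of absolute values of all entries. $\|\cdot\|_1$, $\|\cdot\|$ are the $\ell_1$ and Euclidean norms of vectors. $\Pi^n_o$ is the set of probability vectors in $\mathbb{R}^n$ with all coordinates positive; $\mathbf{p}_j=(p_{1,j},\ldots,p_{n,j})$. For $l\in[d]$, $\mathbf{s}_l(\mathcal{A})=(s_{1,l}(\mathcal{A}),\ldots,s_{n,l}(\mathcal{A}))$ with $s_{i_l,l}(\mathcal{A})=\sum_{i_j\in[n],\,j\ne l}a_{i_1,\ldots,i_d}$. $\mathrm{U}(P)=\{\mathcal{U}\in\otimes^d\mathbb{R}^n_+:\ \mathbf{s}_j(\mathcal{U})=\mathbf{p}_j,\ j\in[d]\}$. Sinkhorn algorithm started at a tensor $\mathcal{A}_0=[a_{i_1,\ldots,i_d,0}]$: for a tensor $\mathcal{F}$ with positive marginals let $\mathbf{x}_l(\mathcal{F})\in\mathbb{R}^n$ have coordinates $x_{i,l}(\mathcal{F})=\log p_{i,l}-\log s_{i,l}(\mathcal{F})$. Start with $X^{(0)}=\mathbf{0}\in(\mathbb{R}^n)^d$.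 Given $X^{(k-1)}=(\mathbf{x}_1^{(k-1)},\ldots,\mathbf{x}_d^{(k-1)})$, $k\in\mathbb{N}$, put $\mathcal{A}_{k-1}=[\exp(\sum_{j\in[d]}x^{(k-1)}_{i_j,j})\,a_{i_1,\ldots,i_d,0}]$, choose $$\ell(k-1)\in\arg\max\Big\{\Big\|\mathbf{s}_j(\mathcal{A}_{k-1})-\frac{\langle\mathbf{s}_j(\mathcal{A}_{k-1}),\mathbf{p}_j\rangle}{\|\mathbf{p}_j\|^2}\mathbf{p}_j\Big\|_1:\ j\in[d]\Big\},$$ and set $\mathbf{x}^{(k)}_j=\mathbf{x}^{(k-1)}_j$ for $j\ne\ell(k-1)$, and $\mathbf{x}^{(k)}_j=\mathbf{x}^{(k-1)}_j+\mathbf{x}_j(\mathcal{A}_{k-1})$ for $j=\ell(k-1)$. Replacement Algorithm applied to a tensor $\mathcal{F}\in\otimes^d\mathbb{R}^n_+$ with positive marginals: set $\mathcal{F}_0=\mathcal{F}$ and for $j=1,\ldots,d$ let $\mathcal{F}_j=[f_{i_1,\ldots,i_d,j}]$ with $f_{i_1,\ldots,i_d,j}=\min\big(\frac{p_{i_j,j}}{s_{i_j,j}(\mathcal{F}_{j-1})},1\big)f_{i_1,\ldots,i_d,j-1}$. Let $\mathcal{G}=\mathcal{F}_d$, $\mathbf{q}_j=\mathbf{s}_j(\mathcal{G})$ for $j\in[d]$, $h=\|\mathbf{p}_1\|_1=\cdots=\|\mathbf{p}_d\|_1$ (here $h=1$) and $h'=\|\mathcal{G}\|_1$. The output is $\mathcal{B}=\mathcal{G}+\frac{1}{(h-h')^{d-1}}\otimes_{j=1}^d(\mathbf{p}_j-\mathbf{q}_j)$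 if $h'<h$, and $\mathcal{B}=\mathcal{G}$ if $h'=h$.
   Formalization: The case n = 1 with C = 0 is excluded, because there both sides of the strict inequality equal 0 and the claim reads 0 < 0. *)

theory Defs
  imports "HOL-Analysis.Analysis"
begin

text \<open>
  A tensor in \<open>\<otimes>\<^sup>d \<real>\<^sup>n\<close> is a vector of type \<open>real ^ ('n ^ 'd)\<close>: its entries are indexed by the
  multi-indices \<open>i :: 'n ^ 'd\<close>, whose components are \<open>i $ j\<close>. Here \<open>'n\<close> stands for \<open>[n]\<close> and \<open>'d\<close> for
  \<open>[d]\<close>. The linear order on \<open>'d\<close> serves only to fix the order in which the replacement algorithm
  visits the modes. The pairing of tensors is the inner product \<open>\<bullet>\<close>, and the largest absolute value
  of an entry is \<open>infnorm\<close>.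
\<close>

definition l1norm :: "real ^ 'a \<Rightarrow> real" where
  "l1norm x = (\<Sum>i\<in>UNIV. \<bar>x $ i\<bar>)"

definition pos_prob_vectors :: "(real ^ 'n) set" where
  "pos_prob_vectors = {p. (\<forall>a. 0 < p $ a) \<and> (\<Sum>a\<in>UNIV. p $ a) = 1}"

definition marginal :: "'d \<Rightarrow> real ^ ('n ^ 'd) \<Rightarrow> real ^ 'n" where
  "marginal l F = (\<chi> a. \<Sum>i | i $ l = a. F $ i)"

definition transport_polytope :: "real ^ 'n ^ 'd \<Rightarrow> (real ^ ('n ^ 'd)) set" where
  "transport_polytope P = {U. (\<forall>i. 0 \<le> U $ i) \<and> (\<forall>j. marginal j U = P $ j)}"

text \<open>
  \<open>LEAST\<close> is the minimum of the set of costs; it is attained because the polytope is compact, and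
  nonempty for probability vectors.
\<close>

definition tot_value :: "real ^ ('n ^ 'd) \<Rightarrow> real ^ 'n ^ 'd \<Rightarrow> real" where
  "tot_value C P = (LEAST v. v \<in> (\<lambda>U. C \<bullet> U) ` transport_polytope P)"

definition gibbs_tensor :: "real \<Rightarrow> real ^ ('n::finite ^ 'd) \<Rightarrow> real ^ ('n ^ 'd)" where
  "gibbs_tensor lam C = (\<chi> i. exp (- lam * C $ i))"


subsection \<open>Sinkhorn algorithm\<close>

definition rescale :: "real ^ ('n ^ 'd) \<Rightarrow> real ^ 'n ^ 'd \<Rightarrow> real ^ ('n ^ 'd)" where
  "rescale A0 X = (\<chi> i. exp (\<Sum>j\<in>UNIV. X $ j $ (i $ j)) * A0 $ i)"

definition log_ratio :: "real ^ 'n ^ 'd \<Rightarrow> 'd \<Rightarrow> real ^ ('n ^ 'd) \<Rightarrow> real ^ 'n" where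
  "log_ratio P l F = (\<chi> a. ln (P $ l $ a) - ln (marginal l F $ a))"

text \<open>
  The sequence \<open>ell\<close> records the mode rescaled in each step; that it is a greedy choice is a separate
  hypothesis on \<open>ell\<close>, see below.
\<close>

primrec sinkhorn_log :: "real ^ 'n ^ 'd \<Rightarrow> real ^ ('n ^ 'd) \<Rightarrow> (nat \<Rightarrow> 'd) \<Rightarrow> nat \<Rightarrow> real ^ 'n ^ 'd" where
  "sinkhorn_log P A0 ell 0 = 0"
| "sinkhorn_log P A0 ell (Suc k) =
     (\<chi> j. if j = ell k
           then sinkhorn_log P A0 ell k $ j + log_ratio P j (rescale A0 (sinkhorn_log P A0 ell k))
           else sinkhorn_log P A0 ell k $ j)"

definition sinkhorn_tensor ::
    "real ^ 'n ^ 'd \<Rightarrow> real ^ ('n ^ 'd) \<Rightarrow> (nat \<Rightarrow> 'd) \<Rightarrow> nat \<Rightarrow> real ^ ('n ^ 'd)" where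
  "sinkhorn_tensor P A0 ell k = rescale A0 (sinkhorn_log P A0 ell k)"

definition defect :: "real ^ 'n ^ 'd \<Rightarrow> real ^ ('n ^ 'd) \<Rightarrow> 'd \<Rightarrow> real" where
  "defect P F j =
     l1norm (marginal j F - ((marginal j F \<bullet> P $ j) / (norm (P $ j))\<^sup>2) *\<^sub>R (P $ j))"

definition max_defect :: "real ^ 'n ^ 'd \<Rightarrow> real ^ ('n ^ 'd) \<Rightarrow> real" where
  "max_defect P F = Max (range (defect P F))"

definition greedy_choice ::
    "real ^ 'n ^ 'd \<Rightarrow> real ^ ('n ^ 'd) \<Rightarrow> (nat \<Rightarrow> 'd) \<Rightarrow> bool" where
  "greedy_choice P A0 ell \<longleftrightarrow>
     (\<forall>k. is_arg_max (defect P (sinkhorn_tensor P A0 ell k)) (\<lambda>j. j \<in> UNIV) (ell k))"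


subsection \<open>Replacement algorithm\<close>

definition clip_mode :: "real ^ 'n ^ 'd \<Rightarrow> 'd \<Rightarrow> real ^ ('n ^ 'd) \<Rightarrow> real ^ ('n ^ 'd)" where
  "clip_mode P j F = (\<chi> i. min (P $ j $ (i $ j) / marginal j F $ (i $ j)) 1 * F $ i)"

definition clip_all ::
    "real ^ 'n ^ ('d::{finite,linorder}) \<Rightarrow> real ^ ('n ^ ('d::{finite,linorder}))
      \<Rightarrow> real ^ ('n ^ ('d::{finite,linorder}))" where
  "clip_all P F = fold (clip_mode P) (sorted_list_of_set UNIV) F"

definition tensor_product :: "real ^ 'n ^ 'd \<Rightarrow> real ^ ('n ^ 'd)" where
  "tensor_product X = (\<chi> i. \<Prod>j\<in>UNIV. X $ j $ (i $ j))"

text \<open>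
  \<open>P $ Min UNIV\<close> is the first vector \<open>p\<^sub>1\<close>; all the \<open>P $ j\<close> are assumed to have the same
  \<open>\<ell>\<^sub>1\<close> norm \<open>h\<close>. Clipping never leaves total mass larger than \<open>h\<close>, so the last branch is the case
  \<open>h' = h\<close>.
\<close>

definition replacement ::
    "real ^ 'n ^ ('d::{finite,linorder}) \<Rightarrow> real ^ ('n ^ ('d::{finite,linorder}))
      \<Rightarrow> real ^ ('n ^ ('d::{finite,linorder}))" where
  "replacement P F =
     (let G = clip_all P F;
          h = l1norm (P $ Min UNIV);
          h' = l1norm G
      in if h' < h
         then G + (1 / (h - h') ^ (CARD('d) - 1)) *\<^sub>R tensor_product (\<chi> j. P $ j - marginal j G)
         else G)"

end

theory Submission
  imports Defs
begin

text \<open>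
  Every iterate \<open>F\<close> has mass \<open>1\<close>, so a defect below \<open>\<epsilon>\<close> puts its marginals within \<open>2 \<epsilon>\<close> of
  \<open>P\<close>, and the replacement algorithm moves it by at most \<open>\<Sum>\<^sub>j \<parallel>s\<^sub>j(F) - p\<^sub>j\<parallel>\<^sub>1\<close> in
  \<open>\<ell>\<^sub>1\<close>. Since \<open>ln F + lam C\<close> is a sum of functions of single indices, Gibbs' inequality gives
  \<open>\<langle>C, F\<rangle> \<le> \<langle>C, U\<rangle> + d ln n / lam\<close> for every \<open>U\<close> with the marginals of \<open>F\<close>; such a \<open>U\<close> near the
  optimal plan is produced by the replacement algorithm again, with the roles of the marginals
  exchanged. Altogether the error is at most \<open>4 d \<epsilon> \<parallel>C\<parallel>\<^sub>\<infinity>\<close>. The iteration stops because each step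
  raises the potential \<open>\<Sum>\<^sub>j \<langle>p\<^sub>j, x\<^sub>j\<rangle>\<close> by a relative entropy that dominates the squared defect,
  while the potential is bounded above.
\<close>

section \<open>Marginals, product tensors and the \<open>\<ell>\<^sub>1\<close> norm\<close>

lemma sum_component_marginal:
  fixes F :: "real ^ ('n::finite ^ 'd)" and f :: "'n \<Rightarrow> real"
  shows "(\<Sum>i\<in>UNIV. f (i $ l) * F $ i) = (\<Sum>a\<in>UNIV. f a * marginal l F $ a)"
proof -
  have "(\<Sum>a\<in>UNIV. f a * marginal l F $ a)
      = (\<Sum>a\<in>UNIV. \<Sum>i | i \<in> UNIV \<and> i $ l = a. f (i $ l) * F $ i)"
    by (simp add: marginal_def sum_distrib_left)
  also have "\<dots> = (\<Sum>i\<in>UNIV. f (i $ l) * F $ i)"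
    by (rule sum.group) auto
  finally show ?thesis by simp
qed

lemma sum_marginal:
  fixes F :: "real ^ ('n::finite ^ 'd)"
  shows "(\<Sum>a\<in>UNIV. marginal l F $ a) = (\<Sum>i\<in>UNIV. F $ i)"
  using sum_component_marginal[of "\<lambda>_. 1" l F] by simp

text \<open>The pairing of a sum of one-index functions with a tensor sees only its marginals. Hence
  potentials cancel between tensors with equal marginals.\<close>

lemma sum_potential_marginal:
  fixes F :: "real ^ ('n::finite ^ 'd)" and X :: "real ^ 'n::finite ^ 'd"
  shows "(\<Sum>i\<in>UNIV. (\<Sum>j\<in>UNIV. X $ j $ (i $ j)) * F $ i)
       = (\<Sum>j\<in>UNIV. \<Sum>a\<in>UNIV. X $ j $ a * marginal j F $ a)"
proof -
  have "(\<Sum>i\<in>UNIV. (\<Sum>j\<in>UNIV. X $ j $ (i $ j)) * F $ i)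
      = (\<Sum>j\<in>UNIV. \<Sum>i\<in>UNIV. X $ j $ (i $ j) * F $ i)"
    unfolding sum_distrib_right by (rule sum.swap)
  then show ?thesis
    by (simp add: sum_component_marginal)
qed

lemma marginal_mono: "(\<And>i. F $ i \<le> G $ i) \<Longrightarrow> marginal l F $ a \<le> marginal l G $ a"
  by (simp add: marginal_def sum_mono)

lemma marginal_nonneg: "(\<And>i. 0 \<le> F $ i) \<Longrightarrow> 0 \<le> marginal l F $ a"
  by (simp add: marginal_def sum_nonneg)

lemma marginal_pos:
  assumes "\<And>i. 0 < F $ i"
  shows "0 < marginal l F $ a"
proof -
  have "(\<chi> j. a) \<in> {i. i $ l = a}" by simp
  then have "{i. i $ l = a} \<noteq> {}" by blast
  then show ?thesis
    using assms by (auto simp: marginal_def intro!: sum_pos simp del: Collect_empty_eq)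
qed

lemma marginal_add_scaleR:
  "marginal l (F + c *\<^sub>R G) $ a = marginal l F $ a + c * marginal l G $ a"
  by (simp add: marginal_def sum.distrib sum_distrib_left)

lemma marginal_scaled_by_mode:
  assumes "\<And>i. G $ i = f (i $ l) * F $ i"
  shows "marginal l G $ a = f a * marginal l F $ a"
  by (simp add: marginal_def assms sum_distrib_left)

lemma marginal_tensor_product:
  fixes X :: "real ^ 'n::finite ^ 'd"
  shows "marginal l (tensor_product X) $ a
       = X $ l $ a * (\<Prod>j\<in>UNIV - {l}. \<Sum>b\<in>UNIV. X $ j $ b)"
proof -
  \<comment> \<open>Fixing coordinate \<open>l\<close> turns the fibre into a box with side
    \<open>{a}\<close> in mode \<open>l\<close>, over which the sum of products factors.\<close>
  let ?S = "\<lambda>j. if j = l then {a} else UNIV"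
  have "marginal l (tensor_product X) $ a = (\<Sum>i | i $ l = a. \<Prod>j\<in>UNIV. X $ j $ (i $ j))"
    by (simp add: marginal_def tensor_product_def)
  also have "\<dots> = (\<Sum>g\<in>PiE UNIV ?S. \<Prod>j\<in>UNIV. X $ j $ (g j))"
    by (rule sum.reindex_bij_witness[where i = vec_lambda and j = vec_nth])
       (auto simp: PiE_def Pi_def extensional_def split: if_splits)
  also have "\<dots> = (\<Prod>j\<in>UNIV. \<Sum>b\<in>?S j. X $ j $ b)"
    by (rule prod_sum_PiE[symmetric]) auto
  also have "\<dots> = X $ l $ a * (\<Prod>j\<in>UNIV - {l}. \<Sum>b\<in>?S j. X $ j $ b)"
    by (subst prod.remove[of _ l]) auto
  finally show ?thesis by simp
qed

lemma l1norm_eq_sum: "(\<And>i. 0 \<le> x $ i) \<Longrightarrow> l1norm x = (\<Sum>i\<in>UNIV. x $ i)"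
  by (simp add: l1norm_def)

lemma l1norm_minus_commute: "l1norm (x - y) = l1norm (y - x)"
  by (simp add: l1norm_def abs_minus_commute)

lemma l1norm_triangle: "l1norm (x + y) \<le> l1norm x + l1norm y"
  by (simp add: l1norm_def sum_mono abs_triangle_ineq flip: sum.distrib)

text \<open>Hoelder's inequality, used to turn \<open>\<ell>\<^sub>1\<close> distances into
  differences of cost.\<close>

lemma inner_diff_le_infnorm:
  fixes C U V :: "real ^ 'a::finite"
  shows "C \<bullet> U - C \<bullet> V \<le> infnorm C * l1norm (U - V)"
proof -
  have "C \<bullet> U - C \<bullet> V = (\<Sum>i\<in>UNIV. C $ i * (U - V) $ i)"
    by (simp add: inner_vec_def sum_subtractf right_diff_distrib)
  also have "\<dots> \<le> (\<Sum>i\<in>UNIV. infnorm C * \<bar>(U - V) $ i\<bar>)"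
  proof (rule sum_mono)
    fix i
    have "C $ i * (U - V) $ i \<le> \<bar>C $ i\<bar> * \<bar>(U - V) $ i\<bar>"
      by (metis abs_ge_self abs_mult)
    also have "\<dots> \<le> infnorm C * \<bar>(U - V) $ i\<bar>"
      by (intro mult_right_mono component_le_infnorm_cart) simp
    finally show "C $ i * (U - V) $ i \<le> infnorm C * \<bar>(U - V) $ i\<bar>" .
  qed
  finally show ?thesis
    by (simp add: l1norm_def sum_distrib_left)
qed

lemma l1norm_le_card_norm: "l1norm (x :: real ^ 'a::finite) \<le> real CARD('a) * norm x"
  unfolding l1norm_def by (rule sum_bounded_above) (simp add: component_le_norm_cart)


subsection \<open>The replacement algorithm\<close>

lemma clip_mode_bounds:
  assumes "\<And>i. 0 \<le> F $ i" and "\<And>a. 0 \<le> P $ j $ a"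
  shows "0 \<le> clip_mode P j F $ i" and "clip_mode P j F $ i \<le> F $ i"
proof -
  have r: "0 \<le> P $ j $ (i $ j) / marginal j F $ (i $ j)"
    using assms marginal_nonneg[of F] by simp
  show "0 \<le> clip_mode P j F $ i"
    using r assms by (simp add: clip_mode_def)
  show "clip_mode P j F $ i \<le> F $ i"
    using mult_right_mono[OF _ assms(1), of "min (P $ j $ (i $ j) / marginal j F $ (i $ j)) 1" 1 i]
    by (simp add: clip_mode_def)
qed

lemma marginal_clip_mode:
  assumes "\<And>i. 0 \<le> F $ i" and "\<And>a. 0 \<le> P $ j $ a"
  shows "marginal j (clip_mode P j F) $ a = min (P $ j $ a) (marginal j F $ a)"
proof -
  have "marginal j (clip_mode P j F) $ a
      = min (P $ j $ a / marginal j F $ a) 1 * marginal j F $ a"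
    by (rule marginal_scaled_by_mode) (simp add: clip_mode_def)
  \<comment> \<open>A vanishing marginal makes the quotient 0 by convention, and then both sides are
    0.\<close>
  also have "\<dots> = min (P $ j $ a) (marginal j F $ a)"
    using marginal_nonneg[OF assms(1), of j a] assms(2)[of a]
    by (cases "marginal j F $ a = 0") (auto simp: min_def field_simps)
  finally show ?thesis .
qed

text \<open>Clipping only lowers entries. Hence a marginal once clipped stays below its target, and
  clipping mode \<open>j\<close> removes no more than the excess of the original
  \<open>marginal j F\<close> over \<open>P $ j\<close>.\<close>

lemma clip_fold:
  fixes F :: "real ^ ('n::finite ^ 'd)"
  assumes F: "\<And>i. 0 \<le> F $ i" and P: "\<And>j a. 0 \<le> P $ j $ a"
  defines "G \<equiv> \<lambda>js. fold (clip_mode P) js F"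
  shows "(\<forall>i. 0 \<le> G js $ i \<and> G js $ i \<le> F $ i)
       \<and> (\<forall>j\<in>set js. \<forall>a. marginal j (G js) $ a \<le> P $ j $ a)
       \<and> (\<Sum>i\<in>UNIV. F $ i) - (\<Sum>i\<in>UNIV. G js $ i)
           \<le> (\<Sum>j\<leftarrow>js. \<Sum>a\<in>UNIV. max 0 (marginal j F $ a - P $ j $ a))"
proof (induction js rule: rev_induct)
  case Nil
  then show ?case using F by (simp add: G_def)
next
  case (snoc j js)
  have Gs: "G (js @ [j]) = clip_mode P j (G js)" by (simp add: G_def)
  have G0: "0 \<le> G js $ i" and GF: "G js $ i \<le> F $ i" for i using snoc.IH by auto
  note b = clip_mode_bounds[where P = P and j = j, OF G0 P]
  have m: "marginal j (clip_mode P j (G js)) $ a = min (P $ j $ a) (marginal j (G js) $ a)" for a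
    by (rule marginal_clip_mode[OF G0 P])
  have le: "marginal k (clip_mode P j (G js)) $ a \<le> P $ k $ a" if "k \<in> set (js @ [j])" for k a
  proof (cases "k = j")
    case True
    then show ?thesis by (simp add: m)
  next
    case False
    then have "marginal k (G js) $ a \<le> P $ k $ a" using that snoc.IH by auto
    then show ?thesis
      using marginal_mono[of "clip_mode P j (G js)" "G js" k a] b(2) by force
  qed
  have "(\<Sum>i\<in>UNIV. G js $ i) - (\<Sum>i\<in>UNIV. clip_mode P j (G js) $ i)
      = (\<Sum>a\<in>UNIV. marginal j (G js) $ a - min (P $ j $ a) (marginal j (G js) $ a))"
    by (simp add: sum_subtractf m flip: sum_marginal[of j])
  also have "\<dots> \<le> (\<Sum>a\<in>UNIV. max 0 (marginal j F $ a - P $ j $ a))"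
  proof (rule sum_mono)
    fix a
    show "marginal j (G js) $ a - min (P $ j $ a) (marginal j (G js) $ a)
        \<le> max 0 (marginal j F $ a - P $ j $ a)"
      using marginal_mono[OF GF, of j a] by linarith
  qed
  finally have "(\<Sum>i\<in>UNIV. G js $ i) - (\<Sum>i\<in>UNIV. clip_mode P j (G js) $ i)
      \<le> (\<Sum>a\<in>UNIV. max 0 (marginal j F $ a - P $ j $ a))" .
  moreover have "clip_mode P j (G js) $ i \<le> F $ i" for i
    using b(2) GF order_trans by blast
  ultimately show ?case
    unfolding Gs using snoc.IH b(1) le by auto
qed

text \<open>The positive and negative parts of \<open>x - y\<close> have equal sums, so each carries
  half of the norm.\<close>

lemma sum_max_diff_eq_half_l1norm:
  fixes x y :: "real ^ 'a::finite"
  assumes "(\<Sum>a\<in>UNIV. x $ a) = (\<Sum>a\<in>UNIV. y $ a)"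
  shows "2 * (\<Sum>a\<in>UNIV. max 0 (x $ a - y $ a)) = l1norm (x - y)"
proof -
  have "2 * (\<Sum>a\<in>UNIV. max 0 (x $ a - y $ a)) = (\<Sum>a\<in>UNIV. (x $ a - y $ a) + \<bar>x $ a - y $ a\<bar>)"
    unfolding sum_distrib_left by (rule sum.cong) (auto simp: max_def)
  then show ?thesis
    using assms by (simp add: sum.distrib sum_subtractf l1norm_def)
qed

text \<open>If mass \<open>m\<close> is left after clipping, then clipping moves \<open>F\<close> by
  \<open>1 - m\<close> and the correction adds a nonnegative tensor of mass \<open>1 - m\<close>.
  The total excess in a mode is half the distance of the marginals, which bounds
  \<open>2 * (1 - m)\<close>.\<close>

lemma replacement_transport_and_distance:
  fixes P :: "real ^ 'n::finite ^ ('d::{finite,linorder})"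
    and F :: "real ^ ('n ^ ('d::{finite,linorder}))"
  assumes F: "\<And>i. 0 \<le> F $ i" and mass: "(\<Sum>i\<in>UNIV. F $ i) = 1"
    and P: "\<And>j a. 0 \<le> P $ j $ a" and P1: "\<And>j. (\<Sum>a\<in>UNIV. P $ j $ a) = 1"
  shows "replacement P F \<in> transport_polytope P"
    and "l1norm (replacement P F - F) \<le> (\<Sum>j\<in>UNIV. l1norm (marginal j F - P $ j))"
proof -
  define G where "G = clip_all P F"
  define m where "m = (\<Sum>i\<in>UNIV. G $ i)"
  have cf: "0 \<le> G $ i" "G $ i \<le> F $ i" "marginal j G $ a \<le> P $ j $ a"
    "1 - m \<le> (\<Sum>j\<in>UNIV. \<Sum>a\<in>UNIV. max 0 (marginal j F $ a - P $ j $ a))" for i j a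
    using clip_fold[of F P "sorted_list_of_set UNIV", OF F P] mass
    by (auto simp: G_def m_def clip_all_def sum_list_distinct_conv_sum_set)
  have half: "2 * (\<Sum>a\<in>UNIV. max 0 (marginal j F $ a - P $ j $ a))
      = l1norm (marginal j F - P $ j)" for j
    by (rule sum_max_diff_eq_half_l1norm) (simp add: sum_marginal mass P1)
  have lost: "2 * (1 - m) \<le> (\<Sum>j\<in>UNIV. l1norm (marginal j F - P $ j))"
    using cf(4) by (simp flip: half sum_distrib_left)
  have m_le: "m \<le> 1" using cf(2) mass by (metis m_def sum_mono)
  have h: "l1norm (P $ Min UNIV) = 1" using P P1 by (simp add: l1norm_eq_sum)
  have h': "l1norm G = m" using cf(1) by (simp add: l1norm_eq_sum m_def)
  have GF: "l1norm (G - F) = 1 - m"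
    using cf(2) mass by (simp add: l1norm_def m_def sum_subtractf)
  have "replacement P F \<in> transport_polytope P \<and> l1norm (replacement P F - F) \<le> 2 * (1 - m)"
  proof (cases "m < 1")
    case True
    define D where "D = (\<chi> j. P $ j - marginal j G)"
    define c where "c = 1 / (1 - m) ^ (CARD('d) - 1)"
    have c0: "0 \<le> c" using True by (simp add: c_def)
    have B: "replacement P F = G + c *\<^sub>R tensor_product D"
      using True h h' by (simp add: replacement_def Let_def c_def D_def flip: G_def)
    have T0: "0 \<le> tensor_product D $ i" for i
      using cf(3) by (simp add: tensor_product_def D_def prod_nonneg)
    have D1: "(\<Sum>a\<in>UNIV. D $ j $ a) = 1 - m" for j
      by (simp add: D_def sum_subtractf P1 sum_marginal m_def)
    \<comment> \<open>Each mode other than \<open>j\<close> contributes a factor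
      \<open>1 - m\<close>, and \<open>c\<close> cancels their product.\<close>
    have cD: "c * marginal j (tensor_product D) $ a = D $ j $ a" for j a
      using True by (simp add: marginal_tensor_product D1 c_def)
    have mB: "marginal j (replacement P F) $ a = P $ j $ a" for j a
      by (simp add: B marginal_add_scaleR cD) (simp add: D_def)
    have B0: "0 \<le> replacement P F $ i" for i
      using c0 T0 cf(1) by (simp add: B)
    have "(\<Sum>i\<in>UNIV. c * tensor_product D $ i) = 1 - m"
      using D1[of "Min UNIV"] sum_marginal[of "Min UNIV" "tensor_product D"]
      by (simp flip: cD sum_distrib_left)
    then have "l1norm (c *\<^sub>R tensor_product D) = 1 - m"
      using c0 T0 by (simp add: l1norm_eq_sum)
    then have "l1norm (replacement P F - F) \<le> l1norm (G - F) + (1 - m)"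
      using l1norm_triangle[of "G - F" "c *\<^sub>R tensor_product D"] by (simp add: B algebra_simps)
    with GF mB B0 show ?thesis
      by (simp add: transport_polytope_def vec_eq_iff)
  next
    case False
    with m_le have m1: "m = 1" by simp
    have B: "replacement P F = G"
      using m1 h h' by (simp add: replacement_def Let_def flip: G_def)
    \<comment> \<open>No mass was lost, so these nonnegative gaps sum to 0 in every mode.\<close>
    have "P $ j $ a - marginal j G $ a = 0" for j a
    proof -
      have "(\<Sum>a\<in>UNIV. P $ j $ a - marginal j G $ a) = 0"
        using m1 by (simp add: sum_subtractf P1 sum_marginal m_def)
      then show ?thesis
        using cf(3) by (subst (asm) sum_nonneg_eq_0_iff) auto
    qed
    with GF m1 cf(1) show ?thesis
      unfolding B by (simp add: transport_polytope_def vec_eq_iff)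
  qed
  with lost show "replacement P F \<in> transport_polytope P"
    and "l1norm (replacement P F - F) \<le> (\<Sum>j\<in>UNIV. l1norm (marginal j F - P $ j))"
    by auto
qed


subsection \<open>The optimal value\<close>

lemma tensor_product_transport:
  assumes "\<And>j a. 0 \<le> P $ j $ a" and "\<And>j. (\<Sum>a\<in>UNIV. P $ j $ a) = 1"
  shows "tensor_product P \<in> transport_polytope P"
  unfolding transport_polytope_def
  by (auto simp: vec_eq_iff marginal_tensor_product assms)
     (simp add: tensor_product_def assms prod_nonneg)

lemma compact_transport_polytope: "compact (transport_polytope P)"
proof -
  have "transport_polytope P
      = {U. (\<forall>i. 0 \<le> U $ i) \<and> (\<forall>j a. (\<Sum>i | i $ j = a. U $ i) = P $ j $ a)}"
    by (auto simp: transport_polytope_def vec_eq_iff marginal_def)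
  then have "closed (transport_polytope P)"
    by (auto intro!: closed_Collect_conj closed_Collect_all closed_Collect_le closed_Collect_eq
        continuous_intros)
  moreover have "bounded (transport_polytope P)"
  proof (rule bounded_subset[OF bounded_cbox])
    \<comment> \<open>An entry is at most any marginal to which it contributes; one arbitrary mode
      suffices for the bound.\<close>
    show "transport_polytope P \<subseteq> cbox 0 (\<chi> i. P $ (SOME j. True) $ (i $ (SOME j. True)))"
    proof
      fix U assume U: "U \<in> transport_polytope P"
      have "U $ i \<le> marginal j U $ (i $ j)" for i j
        unfolding marginal_def using U
        by (auto simp: transport_polytope_def intro!: member_le_sum)
      then show "U \<in> cbox 0 (\<chi> i. P $ (SOME j. True) $ (i $ (SOME j. True)))"
        using U by (auto simp: transport_polytope_def mem_box_cart)
    qed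
  qed
  ultimately show ?thesis by (simp add: compact_eq_bounded_closed)
qed

lemma tot_value_attained:
  assumes "transport_polytope P \<noteq> {}"
  obtains U where "U \<in> transport_polytope P" and "tot_value C P = C \<bullet> U"
proof -
  have "continuous_on (transport_polytope P) (\<lambda>U. C \<bullet> U)"
    by (intro continuous_intros)
  then obtain U where U: "U \<in> transport_polytope P"
    "\<forall>V\<in>transport_polytope P. C \<bullet> U \<le> C \<bullet> V"
    using continuous_attains_inf[OF compact_transport_polytope assms] by blast
  then have "tot_value C P = C \<bullet> U"
    unfolding tot_value_def by (intro Least_equality) auto
  with U(1) show ?thesis using that by blast
qed


subsection \<open>Scalings of the Gibbs tensor\<close>

text \<open>Gibbs' inequality against the uniform distribution, from \<open>ln x \<le> x - 1\<close>
  at \<open>x = 1 / (?N * F $ i)\<close>.\<close>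

lemma entropy_le_ln_card:
  fixes F :: "real ^ 'a::finite"
  assumes F: "\<And>i. 0 < F $ i" and mass: "(\<Sum>i\<in>UNIV. F $ i) = 1"
  shows "- (\<Sum>i\<in>UNIV. F $ i * ln (F $ i)) \<le> ln (real CARD('a))"
proof -
  let ?N = "real CARD('a)"
  have "(\<Sum>i\<in>UNIV. - (F $ i * ln (F $ i)) - F $ i * ln ?N) \<le> (\<Sum>i\<in>UNIV. 1 / ?N - F $ i)"
  proof (rule sum_mono)
    fix i
    have "F $ i * ln (1 / (?N * F $ i)) \<le> F $ i * (1 / (?N * F $ i) - 1)"
      using F[of i] by (intro mult_left_mono ln_le_minus_one) (auto intro: less_imp_le)
    also have "\<dots> = 1 / ?N - F $ i"
      using F[of i] by (simp add: field_simps)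
    finally show "- (F $ i * ln (F $ i)) - F $ i * ln ?N \<le> 1 / ?N - F $ i"
      using F[of i] by (simp add: ln_div ln_mult algebra_simps)
  qed
  also have "\<dots> = 0" by (simp add: sum_subtractf mass)
  finally show ?thesis
    by (simp add: sum_subtractf sum_negf mass flip: sum_distrib_right)
qed

text \<open>Pairing \<open>ln F\<close> with \<open>U\<close> and with \<open>F\<close> gives the
  same potential and constant terms, so only \<open>lam\<close> times the difference of costs
  survives. The pairing with \<open>U\<close> is nonpositive because \<open>F $ i \<le> 1\<close>,
  and the entropy of \<open>F\<close> is at most the logarithm of the number of entries.\<close>

lemma entropic_cost_le:
  fixes C F U :: "real ^ ('n::finite ^ 'd)" and X :: "real ^ 'n::finite ^ 'd"
  assumes F: "\<And>i. 0 < F $ i" and mass: "(\<Sum>i\<in>UNIV. F $ i) = 1"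
    and scaling: "\<And>i. ln (F $ i) = (\<Sum>j\<in>UNIV. X $ j $ (i $ j)) - lam * C $ i + c"
    and U: "\<And>i. 0 \<le> U $ i" and marg: "\<And>j. marginal j U = marginal j F"
    and lam: "0 < lam"
  shows "C \<bullet> F \<le> C \<bullet> U + real CARD('d) * ln (real CARD('n)) / lam"
proof -
  have eq: "(\<Sum>i\<in>UNIV. V $ i * ln (F $ i))
      = (\<Sum>j\<in>UNIV. \<Sum>a\<in>UNIV. X $ j $ a * marginal j V $ a)
        - lam * (C \<bullet> V) + c * (\<Sum>i\<in>UNIV. V $ i)" for V :: "real ^ ('n::finite ^ 'd)"
    unfolding sum_potential_marginal[symmetric]
    by (simp add: scaling inner_vec_def sum.distrib sum_subtractf distrib_left right_diff_distrib
        sum_distrib_left mult.commute mult.left_commute)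
  have "(\<Sum>i\<in>UNIV. U $ i) = (\<Sum>i\<in>UNIV. F $ i)"
    by (metis marg sum_marginal)
  then have diff: "lam * (C \<bullet> F)
      = lam * (C \<bullet> U) + (\<Sum>i\<in>UNIV. U $ i * ln (F $ i)) - (\<Sum>i\<in>UNIV. F $ i * ln (F $ i))"
    unfolding eq marg by simp
  have "F $ i \<le> 1" for i
    using member_le_sum[of i UNIV "($) F"] F mass by (simp add: less_imp_le)
  then have "(\<Sum>i\<in>UNIV. U $ i * ln (F $ i)) \<le> 0"
    using U F by (intro sum_nonpos mult_nonneg_nonpos) (auto simp: ln_le_zero_iff)
  moreover have "ln (real CARD('n ^ 'd)) = real CARD('d) * ln (real CARD('n))"
    by (simp add: ln_realpow)
  ultimately have "lam * (C \<bullet> F) \<le> lam * (C \<bullet> U) + real CARD('d) * ln (real CARD('n))"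
    using diff entropy_le_ln_card[OF F mass] by linarith
  with lam show ?thesis by (simp add: field_simps)
qed


subsection \<open>Convergence of the Sinkhorn algorithm\<close>

text \<open>A comparison through the Hellinger distance: with \<open>s\<close> and \<open>t\<close>
  the square roots of the entries, \<open>(t - s)\<^sup>2\<close> is a lower bound for the entropy
  term plus \<open>r $ a - p $ a\<close>. The constant 4 comes from
  \<open>s + t \<le> 2\<close>.\<close>

lemma relative_entropy_ge:
  fixes p r :: "real ^ 'n::finite"
  assumes p: "\<And>a. 0 < p $ a" "(\<Sum>a\<in>UNIV. p $ a) = 1"
    and r: "\<And>a. 0 < r $ a" "(\<Sum>a\<in>UNIV. r $ a) = 1"
  shows "(norm (r - p))\<^sup>2 \<le> 4 * (\<Sum>a\<in>UNIV. p $ a * (ln (p $ a) - ln (r $ a)))"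
proof -
  have le1: "x $ a \<le> 1" if "\<And>a. 0 < x $ a" "(\<Sum>a\<in>UNIV. x $ a) = 1" for x :: "real ^ 'n::finite" and a
    using member_le_sum[of a UNIV "($) x"] that by (simp add: less_imp_le)
  \<comment> \<open>The extra term \<open>r $ a - p $ a\<close> makes the bound hold entrywise and
    sums to 0.\<close>
  have "(r $ a - p $ a)\<^sup>2 / 4 \<le> p $ a * (ln (p $ a) - ln (r $ a)) + (r $ a - p $ a)" for a
  proof -
    define s t where "s = sqrt (p $ a)" and "t = sqrt (r $ a)"
    have st: "0 < s" "0 < t" "s \<le> 1" "t \<le> 1" "p $ a = s\<^sup>2" "r $ a = t\<^sup>2"
      using p(1)[of a] r(1)[of a] le1[OF p] le1[OF r] by (auto simp: s_def t_def less_imp_le)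
    have "(s + t)\<^sup>2 \<le> 2\<^sup>2" using st by (intro power_mono) auto
    then have "(t - s)\<^sup>2 * (s + t)\<^sup>2 \<le> (t - s)\<^sup>2 * 4"
      by (intro mult_left_mono) auto
    then have "(t\<^sup>2 - s\<^sup>2)\<^sup>2 \<le> 4 * (t - s)\<^sup>2"
      by (simp add: power2_eq_square algebra_simps)
    moreover have "s\<^sup>2 * ln (t / s) \<le> s\<^sup>2 * (t / s - 1)"
      using st by (intro mult_left_mono ln_le_minus_one) auto
    then have "2 * s\<^sup>2 - 2 * s * t \<le> s\<^sup>2 * (ln (s\<^sup>2) - ln (t\<^sup>2))"
      using st by (simp add: ln_div ln_mult power2_eq_square algebra_simps)
    ultimately show ?thesis
      using power2_diff[of t s] by (simp add: st(5,6) algebra_simps)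
  qed
  then have "(\<Sum>a\<in>UNIV. (r $ a - p $ a)\<^sup>2 / 4)
      \<le> (\<Sum>a\<in>UNIV. p $ a * (ln (p $ a) - ln (r $ a)) + (r $ a - p $ a))"
    by (rule sum_mono)
  moreover have "(norm (r - p))\<^sup>2 = (\<Sum>a\<in>UNIV. (r $ a - p $ a)\<^sup>2)"
    by (simp add: power2_norm_eq_inner inner_vec_def) (simp add: power2_eq_square)
  ultimately show ?thesis
    by (simp add: sum.distrib sum_subtractf p r flip: sum_divide_distrib)
qed

text \<open>
  The defect is the \<open>\<ell>\<^sub>1\<close> norm of the orthogonal projection of \<open>s\<^sub>j(F) - p\<^sub>j\<close> to the complement of
  \<open>p\<^sub>j\<close>.
\<close>

lemma defect_le_norm:
  fixes P :: "real ^ 'n::finite ^ 'd"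
  shows "defect P F j \<le> real CARD('n) * norm (marginal j F - P $ j)"
proof -
  define p w where "p = P $ j" and "w = marginal j F - P $ j"
  define v where "v = marginal j F - ((marginal j F \<bullet> P $ j) / (norm (P $ j))\<^sup>2) *\<^sub>R P $ j"
  \<comment> \<open>Subtracting \<open>p\<close> does not change the component orthogonal to
    \<open>p\<close>. For \<open>p = 0\<close> the quotient is 0 by convention.\<close>
  have v: "v = w - ((w \<bullet> p) / (p \<bullet> p)) *\<^sub>R p"
    by (cases "p = 0")
      (simp_all add: v_def w_def p_def inner_diff_left power2_norm_eq_inner diff_divide_distrib
        scaleR_diff_left)
  have "(w - v) \<bullet> v = 0"
    by (cases "p = 0") (simp_all add: v inner_diff_right inner_diff_left inner_commute)
  then have "w \<bullet> w = v \<bullet> v + (w - v) \<bullet> (w - v)"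
    by (simp add: inner_diff_left inner_diff_right inner_commute)
  then have "norm v \<le> norm w" by (simp add: norm_le)
  then have "real CARD('n) * norm v \<le> real CARD('n) * norm w" by simp
  moreover have "defect P F j = l1norm v" by (simp add: defect_def v_def)
  ultimately show ?thesis
    using l1norm_le_card_norm[of v] unfolding w_def by linarith
qed

text \<open>The residual \<open>v\<close> has total \<open>1 - t\<close>, so its norm bounds
  \<open>\<bar>t - 1\<bar>\<close>. Replacing the coefficient \<open>t\<close> by 1 therefore costs
  at most one more defect.\<close>

lemma l1norm_marginal_le_defect:
  fixes P :: "real ^ 'n::finite ^ 'd"
  assumes mass: "(\<Sum>i\<in>UNIV. F $ i) = 1" and P: "P $ j \<in> pos_prob_vectors"
  shows "l1norm (marginal j F - P $ j) \<le> 2 * defect P F j"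
proof -
  define t where "t = (marginal j F \<bullet> P $ j) / (norm (P $ j))\<^sup>2"
  define v where "v = marginal j F - t *\<^sub>R P $ j"
  have P': "\<And>a. 0 < P $ j $ a" "(\<Sum>a\<in>UNIV. P $ j $ a) = 1"
    using P by (auto simp: pos_prob_vectors_def)
  have "(\<Sum>a\<in>UNIV. v $ a) = 1 - t"
    by (simp add: v_def sum_subtractf sum_marginal mass P' flip: sum_distrib_left)
  then have t: "\<bar>t - 1\<bar> \<le> l1norm v"
    using sum_abs[of "($) v" UNIV] by (simp add: l1norm_def)
  have "l1norm (marginal j F - P $ j) \<le> (\<Sum>a\<in>UNIV. \<bar>v $ a\<bar> + \<bar>t - 1\<bar> * P $ j $ a)"
    unfolding l1norm_def
  proof (rule sum_mono)
    fix a
    have "(marginal j F - P $ j) $ a = v $ a + (t - 1) * P $ j $ a"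
      by (simp add: v_def algebra_simps)
    then show "\<bar>(marginal j F - P $ j) $ a\<bar> \<le> \<bar>v $ a\<bar> + \<bar>t - 1\<bar> * P $ j $ a"
      using abs_triangle_ineq[of "v $ a" "(t - 1) * P $ j $ a"] P'(1)[of a]
      by (simp add: abs_mult)
  qed
  also have "\<dots> = l1norm v + \<bar>t - 1\<bar>"
    by (simp add: sum.distrib l1norm_def P' flip: sum_distrib_left)
  finally show ?thesis using t by (simp add: defect_def v_def t_def)
qed

lemma sinkhorn_tensor_pos:
  "(\<And>i. 0 < A0 $ i) \<Longrightarrow> 0 < sinkhorn_tensor P A0 ell k $ i"
  by (simp add: sinkhorn_tensor_def rescale_def)

text \<open>Exponentiating the logarithmic update gives the multiplicative form of the step;
  positivity lets \<open>exp\<close> undo \<open>ln\<close>.\<close>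

lemma sinkhorn_tensor_Suc:
  fixes P :: "real ^ 'n::finite ^ 'd" and ell :: "nat \<Rightarrow> 'd"
  assumes A0: "\<And>i. 0 < A0 $ i" and P: "\<And>j a. 0 < P $ j $ a"
  defines "F \<equiv> sinkhorn_tensor P A0 ell"
  shows "F (Suc k) $ i
       = P $ ell k $ (i $ ell k) / marginal (ell k) (F k) $ (i $ ell k) * F k $ i"
proof -
  let ?X = "sinkhorn_log P A0 ell" and ?L = "\<lambda>j. log_ratio P j (F k) $ (i $ j)"
  have F: "0 < F m $ i" for m i unfolding F_def using A0 by (rule sinkhorn_tensor_pos)
  have "(\<Sum>j\<in>UNIV. ?X (Suc k) $ j $ (i $ j))
      = (\<Sum>j\<in>UNIV. ?X k $ j $ (i $ j) + (if j = ell k then ?L j else 0))"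
    by (rule sum.cong) (auto simp: F_def sinkhorn_tensor_def)
  also have "\<dots> = (\<Sum>j\<in>UNIV. ?X k $ j $ (i $ j)) + ?L (ell k)"
    by (simp add: sum.distrib)
  finally have "F (Suc k) $ i = exp (?L (ell k)) * F k $ i"
    by (simp add: F_def sinkhorn_tensor_def rescale_def exp_add)
  then show ?thesis
    using P marginal_pos[of "F k", OF F] by (simp add: log_ratio_def exp_diff)
qed

text \<open>No induction is called for: after any step the mode just rescaled has marginal exactly
  \<open>P $ ell m\<close>, which sums to 1.\<close>

lemma sinkhorn_tensor_mass:
  fixes P :: "real ^ 'n::finite ^ 'd"
  assumes A0: "\<And>i. 0 < A0 $ i" and mass: "(\<Sum>i\<in>UNIV. A0 $ i) = 1"
    and P: "\<And>j. P $ j \<in> pos_prob_vectors"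
  shows "(\<Sum>i\<in>UNIV. sinkhorn_tensor P A0 ell k $ i) = 1"
proof (cases k)
  case 0
  then show ?thesis by (simp add: sinkhorn_tensor_def rescale_def mass)
next
  case (Suc m)
  let ?F = "sinkhorn_tensor P A0 ell"
  have P': "\<And>j a. 0 < P $ j $ a" "\<And>j. (\<Sum>a\<in>UNIV. P $ j $ a) = 1"
    using P by (auto simp: pos_prob_vectors_def)
  have "marginal (ell m) (?F (Suc m)) $ a = P $ ell m $ a" for a
    using marginal_pos[OF sinkhorn_tensor_pos[OF A0], of "ell m" P ell m a]
      marginal_scaled_by_mode[OF sinkhorn_tensor_Suc[OF A0 P'(1)], of ell m a]
    by simp
  then show ?thesis
    using sum_marginal[of "ell m" "?F (Suc m)"] P'(2) Suc by simp
qed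

lemma sinkhorn_terminates:
  fixes P :: "real ^ 'n::finite ^ 'd"
  assumes A0: "\<And>i. 0 < A0 $ i" and mass: "(\<Sum>i\<in>UNIV. A0 $ i) = 1"
    and P: "\<And>j. P $ j \<in> pos_prob_vectors"
    and greedy: "greedy_choice P A0 ell" and \<epsilon>: "0 < \<epsilon>"
  shows "\<exists>k. max_defect P (sinkhorn_tensor P A0 ell k) < \<epsilon>"
proof (rule ccontr)
  assume neg: "\<nexists>k. max_defect P (sinkhorn_tensor P A0 ell k) < \<epsilon>"
  define F where "F = sinkhorn_tensor P A0 ell"
  define X where "X = sinkhorn_log P A0 ell"
  define \<phi> where "\<phi> k = (\<Sum>j\<in>UNIV. \<Sum>a\<in>UNIV. X k $ j $ a * P $ j $ a)" for k
  \<comment> \<open>An explicit tensor with marginals \<open>P\<close>, which rewrites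
    \<open>\<phi>\<close> as a pairing over multi-indices.\<close>
  define W where "W = tensor_product P"
  \<comment> \<open>The gain per step: \<open>\<epsilon>\<close> is at most \<open>CARD('n)\<close>
    times the norm of the marginal error, whose square is at most 4 times the relative
    entropy.\<close>
  define \<delta> where "\<delta> = \<epsilon>\<^sup>2 / (4 * (real CARD('n))\<^sup>2)"
  have P': "\<And>j a. 0 < P $ j $ a" "\<And>j. (\<Sum>a\<in>UNIV. P $ j $ a) = 1"
    using P by (auto simp: pos_prob_vectors_def)
  have Fpos: "0 < F k $ i" for k i unfolding F_def using A0 by (rule sinkhorn_tensor_pos)
  have Fmass: "(\<Sum>i\<in>UNIV. F k $ i) = 1" for k
    unfolding F_def using A0 mass P by (rule sinkhorn_tensor_mass)
  have W: "W \<in> transport_polytope P"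
    unfolding W_def using P' by (intro tensor_product_transport) (auto intro: less_imp_le)
  have step: "\<phi> (Suc k) \<ge> \<phi> k + \<delta>" for k
  proof -
    let ?l = "ell k" and ?r = "marginal (ell k) (F k)"
    define KL where "KL = (\<Sum>a\<in>UNIV. P $ ?l $ a * (ln (P $ ?l $ a) - ln (?r $ a)))"
    have "\<phi> (Suc k) = (\<Sum>j\<in>UNIV. (\<Sum>a\<in>UNIV. X k $ j $ a * P $ j $ a) + (if j = ?l then KL else 0))"
      unfolding \<phi>_def
      by (rule sum.cong)
         (auto simp: X_def KL_def F_def sinkhorn_tensor_def log_ratio_def algebra_simps
           simp flip: sum.distrib sum_subtractf)
    then have \<phi>: "\<phi> (Suc k) = \<phi> k + KL"
      by (simp add: sum.distrib \<phi>_def)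
    have "defect P (F k) j \<le> defect P (F k) ?l" for j
      using greedy by (force simp: greedy_choice_def is_arg_max_def F_def not_less)
    then have "max_defect P (F k) \<le> defect P (F k) ?l"
      by (auto simp: max_defect_def)
    then have "\<epsilon> \<le> defect P (F k) ?l"
      using neg unfolding F_def by (meson not_less order.trans)
    also have "\<dots> \<le> real CARD('n) * norm (?r - P $ ?l)"
      by (rule defect_le_norm)
    finally have "\<epsilon>\<^sup>2 \<le> (real CARD('n) * norm (?r - P $ ?l))\<^sup>2"
      using \<epsilon> by (intro power_mono) auto
    moreover have "(norm (?r - P $ ?l))\<^sup>2 \<le> 4 * KL"
      unfolding KL_def
      by (rule relative_entropy_ge) (use P' marginal_pos[OF Fpos] in \<open>auto simp: sum_marginal Fmass\<close>)
    then have "(real CARD('n))\<^sup>2 * (norm (?r - P $ ?l))\<^sup>2 \<le> (real CARD('n))\<^sup>2 * (4 * KL)"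
      by (intro mult_left_mono) auto
    ultimately have "\<epsilon>\<^sup>2 \<le> (real CARD('n))\<^sup>2 * (4 * KL)"
      unfolding power_mult_distrib by linarith
    then have "\<delta> \<le> KL"
      by (simp add: \<delta>_def divide_le_eq mult.commute mult.left_commute)
    with \<phi> show ?thesis by simp
  qed
  have lower: "\<phi> k \<ge> real k * \<delta>" for k
  proof (induction k)
    case 0
    then show ?case by (simp add: \<phi>_def X_def)
  next
    case (Suc k)
    then show ?case using step[of k] by (simp add: algebra_simps)
  qed
  \<comment> \<open>The entries of \<open>F k\<close> are at most 1, so the potential plus
    \<open>ln (A0 $ i)\<close> is nonpositive; this is averaged against \<open>W\<close>.\<close>
  have upper: "\<phi> k \<le> (\<Sum>i\<in>UNIV. - ln (A0 $ i) * W $ i)" for k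
  proof -
    have "\<phi> k = (\<Sum>i\<in>UNIV. (\<Sum>j\<in>UNIV. X k $ j $ (i $ j)) * W $ i)"
      using W by (simp add: sum_potential_marginal \<phi>_def transport_polytope_def)
    also have "\<dots> \<le> (\<Sum>i\<in>UNIV. - ln (A0 $ i) * W $ i)"
    proof (intro sum_mono mult_right_mono)
      fix i
      have "F k $ i \<le> 1"
        using member_le_sum[of i UNIV "($) (F k)"] Fpos Fmass by (simp add: less_imp_le)
      then have "ln (F k $ i) \<le> 0" using Fpos by (simp add: ln_le_zero_iff)
      then show "(\<Sum>j\<in>UNIV. X k $ j $ (i $ j)) \<le> - ln (A0 $ i)"
        using A0[of i] by (simp add: F_def X_def sinkhorn_tensor_def rescale_def ln_mult)
      show "0 \<le> W $ i" using W by (simp add: transport_polytope_def)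
    qed
    finally show ?thesis .
  qed
  have "0 < \<delta>" using \<epsilon> by (simp add: \<delta>_def)
  then obtain k where "(\<Sum>i\<in>UNIV. - ln (A0 $ i) * W $ i) < real k * \<delta>"
    using reals_Archimedean3 by blast
  with lower[of k] upper[of k] show False by linarith
qed


text \<open>For \<open>CARD('n) = 1\<close> and \<open>C = 0\<close> both sides of the strict
  inequality are 0, so this case is excluded. The first conjunct guarantees that the
  \<open>LEAST\<close> defining \<open>kstop\<close> is taken over a nonempty set.\<close>

theorem theorem3p7:
  fixes P :: "real ^ 'n ^ ('d::{finite,linorder})"
    and C A A0 B :: "real ^ ('n ^ ('d::{finite,linorder}))"
    and lam \<epsilon> :: real
    and ell :: "nat \<Rightarrow> 'd"
    and kstop :: nat
  assumes "2 \<le> CARD('d)"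
    and "\<forall>j. P $ j \<in> pos_prob_vectors"
    and "\<not> (CARD('n) = 1 \<and> C = 0)"
    and "0 < lam"
    and "0 < \<epsilon>" and "\<epsilon> < 1 / 2"
    and "A = gibbs_tensor lam C"
    and "A0 = (1 / l1norm A) *\<^sub>R A"
    and "greedy_choice P A0 ell"
    and "kstop = (LEAST k. max_defect P (sinkhorn_tensor P A0 ell k) < \<epsilon>)"
    and "B = replacement P (sinkhorn_tensor P A0 ell kstop)"
  shows "(\<exists>k. max_defect P (sinkhorn_tensor P A0 ell k) < \<epsilon>) \<and>
         B \<in> transport_polytope P \<and>
         C \<bullet> B < tot_value C P + real CARD('d) * ln (real CARD('n)) / lam
                   + 8 * real CARD('d) * infnorm C * \<epsilon>"
proof -
  let ?S = "sinkhorn_tensor P A0 ell"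
  have P: "P $ j \<in> pos_prob_vectors" for j using assms(2) by simp
  then have P': "0 < P $ j $ a" "0 \<le> P $ j $ a" "(\<Sum>a\<in>UNIV. P $ j $ a) = 1" for j a
    by (auto simp: pos_prob_vectors_def less_imp_le)
  have A: "0 < A $ i" for i by (simp add: assms(7) gibbs_tensor_def)
  have Z: "l1norm A = (\<Sum>i\<in>UNIV. A $ i)" "0 < l1norm A"
    using A by (auto simp: l1norm_def less_imp_le intro!: sum_pos)
  have A0: "0 < A0 $ i" for i using A Z by (simp add: assms(8))
  have A0_mass: "(\<Sum>i\<in>UNIV. A0 $ i) = 1"
    using Z by (simp add: assms(8) flip: sum_divide_distrib)
  have stop: "\<exists>k. max_defect P (?S k) < \<epsilon>"
    by (rule sinkhorn_terminates[OF A0 A0_mass P assms(9,5)])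
  define F where "F = ?S kstop"
  have "max_defect P F < \<epsilon>"
    unfolding F_def assms(10) using stop by (rule LeastI_ex)
  then have small: "defect P F j < \<epsilon>" for j
    by (simp add: max_defect_def)
  have F: "0 < F $ i" "0 \<le> F $ i" for i
    using sinkhorn_tensor_pos[of A0] A0 by (auto simp: F_def intro: less_imp_le)
  have mass: "(\<Sum>i\<in>UNIV. F $ i) = 1"
    unfolding F_def using A0 A0_mass P by (rule sinkhorn_tensor_mass)
  have "(\<Sum>j\<in>UNIV. l1norm (marginal j F - P $ j)) \<le> real CARD('d) * (2 * \<epsilon>)"
  proof (rule sum_bounded_above)
    show "l1norm (marginal j F - P $ j) \<le> 2 * \<epsilon>" for j
      using l1norm_marginal_le_defect[OF mass P, of j] small[of j] by linarith
  qed
  then have dist: "(\<Sum>j\<in>UNIV. l1norm (marginal j F - P $ j)) \<le> 2 * real CARD('d) * \<epsilon>"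
    by simp
  have B: "B = replacement P F" by (simp add: F_def assms(11))
  have BU: "B \<in> transport_polytope P" and BF: "l1norm (B - F) \<le> 2 * real CARD('d) * \<epsilon>"
    using replacement_transport_and_distance[OF F(2) mass P'(2,3)] dist by (auto simp: B)
  obtain U where U: "U \<in> transport_polytope P" "tot_value C P = C \<bullet> U"
    using tot_value_attained BU by blast
  \<comment> \<open>The optimal \<open>U\<close> has marginals \<open>P\<close>, but
    \<open>F\<close> can only be compared with tensors having its own marginals \<open>S\<close>.
    Hence \<open>U\<close> is moved to \<open>V\<close>.\<close>
  define S where "S = (\<chi> j. marginal j F)"
  define V where "V = replacement S U"
  have U0: "0 \<le> U $ i" and mU: "marginal j U = P $ j" for i j
    using U(1) by (auto simp: transport_polytope_def)
  have U1: "(\<Sum>i\<in>UNIV. U $ i) = 1"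
    using sum_marginal[of "Min UNIV" U] by (simp add: mU P'(3))
  have S: "0 \<le> S $ j $ a" "(\<Sum>a\<in>UNIV. S $ j $ a) = 1" for j a
    using marginal_nonneg[OF F(2)] by (simp_all add: S_def sum_marginal mass)
  have VS: "V \<in> transport_polytope S" and "l1norm (V - U) \<le> (\<Sum>j\<in>UNIV. l1norm (P $ j - S $ j))"
    using replacement_transport_and_distance[OF U0 U1 S] by (auto simp: V_def mU)
  then have VU: "l1norm (V - U) \<le> 2 * real CARD('d) * \<epsilon>"
    using dist by (simp add: S_def l1norm_minus_commute[of "P $ _"])
  \<comment> \<open>The constant \<open>- ln (l1norm A)\<close> stems from the normalisation of
    \<open>A0\<close>.\<close>
  have "ln (F $ i) = (\<Sum>j\<in>UNIV. sinkhorn_log P A0 ell kstop $ j $ (i $ j)) - lam * C $ i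
      + - ln (l1norm A)" for i
    using Z by (simp add: F_def sinkhorn_tensor_def rescale_def assms(7,8) gibbs_tensor_def
        ln_mult ln_div)
  from entropic_cost_le[OF F(1) mass this _ _ assms(4), of V]
  have FV: "C \<bullet> F \<le> C \<bullet> V + real CARD('d) * ln (real CARD('n)) / lam"
    using VS by (simp add: transport_polytope_def S_def)
  have ic: "C \<bullet> Y - C \<bullet> Z \<le> 2 * (real CARD('d) * infnorm C * \<epsilon>)"
    if "l1norm (Y - Z) \<le> 2 * real CARD('d) * \<epsilon>" for Y Z
    using inner_diff_le_infnorm[of C Y Z] mult_left_mono[OF that infnorm_pos_le[of C]]
    by (simp add: mult.commute mult.left_commute)
  \<comment> \<open>The replacement error enters twice, for \<open>B\<close> against
    \<open>F\<close> and for \<open>V\<close> against \<open>U\<close>.\<close>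
  have main: "C \<bullet> B \<le> tot_value C P + real CARD('d) * ln (real CARD('n)) / lam
      + 4 * real CARD('d) * infnorm C * \<epsilon>"
    using ic[OF BF] ic[OF VU] FV U(2) by linarith
  have "C \<bullet> B < tot_value C P + real CARD('d) * ln (real CARD('n)) / lam
      + 8 * real CARD('d) * infnorm C * \<epsilon>"
  \<comment> \<open>Strictness: for \<open>C = 0\<close> the bound exceeds the optimum by the
    positive logarithmic term, as \<open>1 < CARD('n)\<close>; otherwise the gap between 4 and 8
    gives it.\<close>
  proof (cases "C = 0")
    case True
    then have "1 < CARD('n)" using assms(3) by (simp add: nat_neq_iff)
    then show ?thesis using True U(2) assms(4) by (simp add: infnorm_0)
  next
    case False
    then have "0 < real CARD('d) * infnorm C * \<epsilon>"
      using assms(5) by (simp add: infnorm_pos_lt)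
    with main show ?thesis by linarith
  qed
  with stop BU show ?thesis by blast
qed

end
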